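(* Let $a$ be an integer with $|a|\ge 3$ and let $b=-1$. Let $(u_n)_{n\ge 0}$ be defined by $u_0=0$, $u_1=1$ and $u_{n+1}=au_n+bu_{n-1}$ for $n\ge 1$. Then $|u_n|$ is composite for all $n\ge 3$.
   Context: A nonnegative integer $m$ is called composite if $m\neq 0,1$ and $m$ is not a prime number. *)

theory Defs
  imports Complex_Main "HOL-Computational_Algebra.Primes"
begin

definition composite :: "nat \<Rightarrow> bool" where
  "composite m \<longleftrightarrow> m \<noteq> 0 \<and> m \<noteq> 1 \<and> \<not> prime m"

end

theory Submission
  imports Defs
begin

text \<open>The addition formula \<open>u\<^bsub>m+n+1\<^esub> = u\<^bsub>m+1\<^esub>u\<^bsub>n+1\<^esub> - u\<^sub>mu\<^sub>n\<close> gives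
  \<open>u\<^bsub>2k+1\<^esub> = (u\<^bsub>k+1\<^esub> - u\<^sub>k)(u\<^bsub>k+1\<^esub> + u\<^sub>k)\<close> and \<open>u\<^bsub>2k+2\<^esub> = u\<^bsub>k+1\<^esub>(u\<^bsub>k+2\<^esub> - u\<^sub>k)\<close>.
  Since \<open>\<bar>a\<bar> \<ge> 3\<close>, the absolute values more than double at each step,
  so for \<open>k \<ge> 1\<close> all of these factors have absolute value at least 2.\<close>

lemma composite_mult:
  fixes x y :: int
  assumes "\<bar>x\<bar> \<ge> 2" and "\<bar>y\<bar> \<ge> 2"
  shows "composite (nat \<bar>x * y\<bar>)"
proof -
  have eq: "nat \<bar>x * y\<bar> = nat \<bar>x\<bar> * nat \<bar>y\<bar>"
    by (simp add: abs_mult nat_mult_distrib)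
  have "nat \<bar>x\<bar> \<noteq> 0" "nat \<bar>x\<bar> \<noteq> 1" "nat \<bar>y\<bar> \<noteq> 0" "nat \<bar>y\<bar> \<noteq> 1"
    using assms by auto
  then show ?thesis
    unfolding composite_def eq
    by (metis mult_is_0 nat_mult_eq_1_iff prime_product)
qed

text \<open>Induction on \<open>n\<close> with \<open>m\<close> free: one index step moves from
  \<open>n\<close> to \<open>m\<close>. Both forms of the right-hand side share the term
  \<open>a * u (Suc m) * u (Suc n)\<close>.\<close>

lemma lucas_addition:
  fixes a :: "'a::comm_ring_1"
  assumes "u 0 = 0" and "u 1 = 1"
    and rec: "\<And>n. u (Suc (Suc n)) = a * u (Suc n) - u n"
  shows "u (Suc (m + n)) = u (Suc m) * u (Suc n) - u m * u n"
proof (induction n arbitrary: m)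
  case 0
  show ?case using assms(1,2) by simp
next
  case (Suc n)
  have "u (Suc (m + Suc n)) = u (Suc (Suc m + n))" by simp
  also have "\<dots> = u (Suc (Suc m)) * u (Suc n) - u (Suc m) * u n"
    by (rule Suc.IH)
  also have "\<dots> = u (Suc m) * u (Suc (Suc n)) - u m * u (Suc n)"
    unfolding rec by (simp add: algebra_simps)
  finally show ?case .
qed

text \<open>The step needs only \<bar>\<open>u (Suc n)\<close>\<bar> \<ge>
  \<bar>\<open>u n\<close>\<bar> + 1, which the induction hypothesis gives; the summand 1 keeps the
  growth strict from \<open>u 0 = 0\<close> on.\<close>

lemma lucas_growth:
  fixes a :: int
  assumes "\<bar>a\<bar> \<ge> 3" and "u 0 = 0" and "u 1 = 1"
    and rec: "\<And>n. u (Suc (Suc n)) = a * u (Suc n) - u n"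
  shows "\<bar>u (Suc n)\<bar> \<ge> 2 * \<bar>u n\<bar> + 1"
proof (induction n)
  case 0
  show ?case using assms(2,3) by simp
next
  case (Suc n)
  have "3 * \<bar>u (Suc n)\<bar> \<le> \<bar>a * u (Suc n)\<bar>"
    unfolding abs_mult using assms(1) by (intro mult_right_mono) auto
  then show ?case using Suc.IH rec[of n] by linarith
qed

theorem theorem6p1:
  fixes a b :: int and u :: "nat \<Rightarrow> int"
  assumes "\<bar>a\<bar> \<ge> 3"
    and "b = -1"
    and "u 0 = 0"
    and "u 1 = 1"
    and "\<And>n. n \<ge> 1 \<Longrightarrow> u (n + 1) = a * u n + b * u (n - 1)"
  shows "\<forall>n\<ge>3. composite (nat \<bar>u n\<bar>)"
proof (intro allI impI)
  fix n :: nat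
  assume n: "n \<ge> 3"
  have rec: "u (Suc (Suc n)) = a * u (Suc n) - u n" for n
    using assms(5)[of "Suc n"] assms(2) by simp
  note add = lucas_addition[of u, OF assms(3,4) rec]
  note growth = lucas_growth[of a u, OF assms(1,3,4) rec]
  \<comment> \<open>Thus \<open>n\<close> is 2k+1 or 2k+2, and \<open>n \<ge> 3\<close> forces k
    \<ge> 1.\<close>
  define k where "k = (n - 1) div 2"
  have "k \<noteq> 0"
    using n unfolding k_def by linarith
  then obtain j where j: "k = Suc j"
    by (cases k) auto
  have k: "\<bar>u k\<bar> \<ge> 1"
    using growth[of j] unfolding j by linarith
  consider "n = Suc (k + k)" | "n = Suc (Suc k + k)"
    using n unfolding k_def by linarith
  then show "composite (nat \<bar>u n\<bar>)"
  proof cases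
    case 1
    then have "u n = (u (Suc k) - u k) * (u (Suc k) + u k)"
      using add[of k k] by (simp add: algebra_simps)
    \<comment> \<open>Both are at least \<bar>\<open>u (Suc k)\<close>\<bar> -
      \<bar>\<open>u k\<close>\<bar> \<ge> \<bar>\<open>u k\<close>\<bar> + 1 \<ge> 2.\<close>
    moreover have "\<bar>u (Suc k) - u k\<bar> \<ge> 2" "\<bar>u (Suc k) + u k\<bar> \<ge> 2"
      using growth[of k] k by linarith+
    ultimately show ?thesis by (simp only: composite_mult)
  next
    case 2
    then have "u n = u (Suc k) * (u (Suc (Suc k)) - u k)"
      using add[of "Suc k" k] by (simp add: algebra_simps)
    moreover have "\<bar>u (Suc k)\<bar> \<ge> 2" "\<bar>u (Suc (Suc k)) - u k\<bar> \<ge> 2"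
      using growth[of k] growth[of "Suc k"] k by linarith+
    ultimately show ?thesis by (simp only: composite_mult)
  qed
qed

end
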